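(* Let $r$ be a negative real number and let $x\in\mathbb{C}$ with $\operatorname{Re}(x)>0$. Then: (1) $\zeta_r(m;x)=0$ for each integer $m$ with $r<m\le 0$; (2) $\Gamma_r(x)=\exp\left(\int_1^\infty(1-u^{-1})^{-r}u^{-x-1}(\log u)^{-1}\,du\right)$.
   Context: For real $r$ and $\operatorname{Re}(x)>0$, the $r$-ple Hurwitz zeta function is $\zeta_r(w;x)=\frac{1}{\Gamma(w)}\int_1^\infty(1-u^{-1})^{-r}u^{-x-1}(\log u)^{w-1}\,du$ (equivalently $\sum_{n\ge0}\binom{n+r-1}{n}(n+x)^{-w}$), defined where the integral converges and extended to all $w\in\mathbb{C}$ by analytic continuation in $w$. The $r$-ple gamma function is $\Gamma_r(x)=\exp\left(\left.\frac{\partial}{\partial w}\zeta_r(w;x)\right|_{w=0}\right)$. *)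

theory Defs
  imports "HOL-Complex_Analysis.Complex_Analysis"
begin

definition hurwitz_integrand :: "real \<Rightarrow> complex \<Rightarrow> complex \<Rightarrow> real \<Rightarrow> complex" where
  "hurwitz_integrand r w x u =
     of_real ((1 - inverse u) powr (- r)) * of_real u powr (- x - 1) * of_real (ln u) powr (w - 1)"

text \<open>For \<open>Re x > 0\<close> this is the half-plane \<open>Re w > r\<close>. The integral does not converge
  conditionally at any further point, so absolute integrability loses nothing.\<close>

definition hurwitz_domain :: "real \<Rightarrow> complex \<Rightarrow> complex set" where
  "hurwitz_domain r x = {w. set_integrable lborel {1<..} (hurwitz_integrand r w x)}"

definition hurwitz_integral :: "real \<Rightarrow> complex \<Rightarrow> complex \<Rightarrow> complex" where
  "hurwitz_integral r w x = rGamma w * (LINT u:{1<..}|lborel. hurwitz_integrand r w x u)"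

text \<open>The value at \<open>w\<close> of the analytic continuation: the common value at \<open>w\<close> of all holomorphic
  extensions of the integral to connected open supersets of its domain of convergence that
  contain \<open>w\<close>. For \<open>Re x > 0\<close> the continuation is meromorphic on the whole plane, so it is
  single-valued, and the description picks out its value at every \<open>w\<close> that is not a pole.
  At a pole there is no such extension and the value is unspecified.\<close>

definition multiple_hurwitz_zeta :: "real \<Rightarrow> complex \<Rightarrow> complex \<Rightarrow> complex" where
  "multiple_hurwitz_zeta r w x =
     (THE v. \<exists>S f. open S \<and> connected S \<and> hurwitz_domain r x \<subseteq> S \<and> w \<in> S \<and>
        f holomorphic_on S \<and> (\<forall>z \<in> hurwitz_domain r x. f z = hurwitz_integral r z x) \<and>
        v = f w)"

definition multiple_Gamma :: "real \<Rightarrow> complex \<Rightarrow> complex" where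
  "multiple_Gamma r x = exp (deriv (\<lambda>w. multiple_hurwitz_zeta r w x) 0)"

end

theory Submission imports Defs begin

text \<open>The integral converges absolutely exactly for \<open>Re w > r\<close>: near \<open>u = 1\<close> the integrand has size
  \<open>(u - 1) powr (Re w - r - 1)\<close>. On this half-plane, which contains \<open>0\<close> because \<open>r < 0\<close>, the integral \<open>J w\<close>
  is holomorphic in \<open>w\<close>, so no continuation is needed and the zeta function is \<open>rGamma w * J w\<close>.
  It vanishes at the zeros of \<open>rGamma\<close>, and since \<open>rGamma\<close> has value \<open>0\<close> and derivative \<open>1\<close> at \<open>0\<close>, its
  derivative there is \<open>J 0\<close>.\<close>

section \<open>Differentiation under the integral sign\<close>

text \<open>Mean value inequality on the disc of radius \<open>norm z\<close>, where the derivative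
  of \<open>exp\<close> has norm at most \<open>exp (norm z)\<close>.\<close>

lemma norm_exp_minus_one_le:
  fixes z :: complex
  shows "norm (exp z - 1) \<le> norm z * exp (norm z)"
proof -
  have "norm (exp z - exp 0) \<le> exp (norm z) * norm (z - 0)"
  proof (rule field_differentiable_bound[of "cball 0 (norm z)" exp exp])
    show "norm (exp y) \<le> exp (norm z)" if "y \<in> cball 0 (norm z)" for y :: complex
      using that norm_exp[of y] by (auto intro: order_trans)
  qed (auto intro: DERIV_exp has_field_derivative_at_within)
  then show ?thesis by (simp add: mult.commute)
qed

text \<open>The difference quotients on \<open>ball w (e/2)\<close> are dominated by the integrands at \<open>w \<plusminus> e\<close>, so
  dominated convergence applies.\<close>

lemma has_field_derivative_integral_powr:
  fixes g :: "'a \<Rightarrow> complex" and L :: "'a \<Rightarrow> real"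
  assumes [measurable]: "g \<in> borel_measurable M" "L \<in> borel_measurable M"
    and L: "\<And>x. x \<in> space M \<Longrightarrow> g x \<noteq> 0 \<Longrightarrow> 0 < L x"
    and U: "open U" "w \<in> U"
    and int: "\<And>z. z \<in> U \<Longrightarrow> integrable M (\<lambda>x. g x * of_real (L x) powr z)"
  shows "((\<lambda>z. \<integral>x. g x * of_real (L x) powr z \<partial>M) has_field_derivative
           (\<integral>x. g x * of_real (L x) powr w * of_real (ln (L x)) \<partial>M)) (at w)"
proof -
  define F where "F z x = g x * of_real (L x) powr z" for z x
  obtain e where e: "e > 0" "cball w e \<subseteq> U"
    using U open_contains_cball by blast
  \<comment> \<open>Halving leaves room for two factors \<open>exp (d * \<bar>l\<bar>)\<close>
    below: one from the increment \<open>h\<close>, one absorbing the logarithm.\<close>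
  define d where "d = e / 2"
  have d: "d > 0" "2 * d = e" using e by (auto simp: d_def)
  \<comment> \<open>If \<open>g x = 0\<close>, both sides vanish; otherwise \<open>L x\<close> is
    positive and its complex logarithm is real.\<close>
  have F_exp: "F z x = g x * exp (z * of_real (ln (L x)))" if "x \<in> space M" for z x
    using L[OF that] by (cases "g x = 0") (auto simp: F_def powr_def Ln_of_real mult.commute)
  have intF: "integrable M (F z)" if "z \<in> cball w e" for z
    using int that e unfolding F_def by blast
  have meas [measurable]: "(\<lambda>x. F w x * of_real (ln (L x))) \<in> borel_measurable M"
  proof -
    have "(\<lambda>x. g x * exp (w * of_real (ln (L x))) * of_real (ln (L x))) \<in> borel_measurable M"
      by measurable
    then show ?thesis by (subst measurable_cong) (auto simp: F_exp)
  qed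
  have bound: "norm ((F z x - F w x) / (z - w)) \<le> (norm (F (w + of_real e) x) + norm (F (w - of_real e) x)) / d"
    if x: "x \<in> space M" and z: "z \<in> ball w d - {w}" for x z
  proof -
    define l where "l = ln (L x)"
    define h where "h = z - w"
    have h: "h \<noteq> 0" "norm h \<le> d" using z by (auto simp: h_def dist_norm norm_minus_commute)
    have "(F z x - F w x) / (z - w) = F w x * ((exp (h * of_real l) - 1) / h)"
      using h by (simp add: F_exp[OF x] h_def l_def exp_diff algebra_simps exp_minus field_simps)
    also have "norm \<dots> = norm (F w x) * (norm (exp (h * of_real l) - 1) / norm h)"
      by (simp add: norm_mult norm_divide)
    also have "\<dots> \<le> norm (F w x) * (norm (h * of_real l) * exp (norm (h * of_real l)) / norm h)"
      by (intro mult_left_mono divide_right_mono norm_exp_minus_one_le) auto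
    also have "\<dots> = norm (F w x) * (\<bar>l\<bar> * exp (norm h * \<bar>l\<bar>))"
      using h by (simp add: norm_mult)
    also have "\<dots> \<le> norm (F w x) * ((exp (d * \<bar>l\<bar>) / d) * exp (d * \<bar>l\<bar>))"
    proof (intro mult_left_mono mult_mono)
      have "d * \<bar>l\<bar> \<le> exp (d * \<bar>l\<bar>)" using exp_ge_add_one_self[of "d * \<bar>l\<bar>"] by linarith
      then show "\<bar>l\<bar> \<le> exp (d * \<bar>l\<bar>) / d" using d by (simp add: field_simps)
    qed (use h d in \<open>auto intro: mult_right_mono\<close>)
    also have "\<dots> = norm (F w x) * exp (e * \<bar>l\<bar>) / d"
      by (simp add: d(2)[symmetric] exp_add[symmetric])
    \<comment> \<open>One of the two summands equals \<open>exp (e * \<bar>l\<bar>)\<close>. The sum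
      avoids a case split on the sign of \<open>l\<close> and produces the integrands at
      \<open>w + e\<close> and \<open>w - e\<close>.\<close>
    also have "\<dots> \<le> norm (F w x) * (exp (e * l) + exp (- e * l)) / d"
      using d by (intro divide_right_mono mult_left_mono) (auto simp: abs_if)
    also have "\<dots> = (norm (F (w + of_real e) x) + norm (F (w - of_real e) x)) / d"
      by (simp add: F_exp[OF x] norm_mult l_def[symmetric] exp_add[symmetric] algebra_simps)
    finally show ?thesis .
  qed
  have lim: "((\<lambda>z. (F z x - F w x) / (z - w)) \<longlongrightarrow> F w x * of_real (ln (L x))) (at w)"
    if x: "x \<in> space M" for x
  proof -
    have "((\<lambda>z. g x * exp (z * of_real (ln (L x)))) has_field_derivative
             g x * exp (w * of_real (ln (L x))) * of_real (ln (L x))) (at w)"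
      by (auto intro!: derivative_eq_intros)
    then show ?thesis
      by (simp add: F_exp[OF x] has_field_derivative_iff)
  qed
  have "((\<lambda>z. ((\<integral>x. F z x \<partial>M) - (\<integral>x. F w x \<partial>M)) / (z - w)) \<longlongrightarrow> (\<integral>x. F w x * of_real (ln (L x)) \<partial>M))
          (at w within ball w d)"
    \<comment> \<open>Dominated convergence is a statement about sequences, so the limit is tested
      along sequences in the punctured ball.\<close>
    unfolding tendsto_at_iff_sequentially
  proof (intro allI impI)
    fix X assume X: "\<forall>i. X i \<in> ball w d - {w}" "X \<longlonglongrightarrow> w"
    have Xe: "X i \<in> cball w e" for i using X(1) d by (auto dest!: spec[of _ i])
    have we: "w \<in> cball w e" "w + of_real e \<in> cball w e" "w - of_real e \<in> cball w e"
      using e by (auto simp: dist_norm)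
    have "(\<lambda>i. \<integral>x. (F (X i) x - F w x) / (X i - w) \<partial>M) \<longlonglongrightarrow> (\<integral>x. F w x * of_real (ln (L x)) \<partial>M)"
    proof (rule integral_dominated_convergence)
      show "integrable M (\<lambda>x. (norm (F (w + of_real e) x) + norm (F (w - of_real e) x)) / d)"
        using we intF by auto
      show "(\<lambda>x. (F (X i) x - F w x) / (X i - w)) \<in> borel_measurable M" for i
        using intF Xe we by (intro borel_measurable_integrable) auto
      have "filterlim X (at w) sequentially"
        using X by (auto simp: filterlim_at eventually_sequentially)
      then show "AE x in M. (\<lambda>i. (F (X i) x - F w x) / (X i - w)) \<longlonglongrightarrow> F w x * of_real (ln (L x))"
        by (intro AE_I2 filterlim_compose[OF lim])
      show "AE x in M. norm ((F (X i) x - F w x) / (X i - w))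
              \<le> (norm (F (w + of_real e) x) + norm (F (w - of_real e) x)) / d" for i
        using bound X(1) by auto
    qed simp
    then show "((\<lambda>z. ((\<integral>x. F z x \<partial>M) - (\<integral>x. F w x \<partial>M)) / (z - w)) \<circ> X)
          \<longlonglongrightarrow> (\<integral>x. F w x * of_real (ln (L x)) \<partial>M)"
      using intF Xe we by (simp add: o_def)
  qed
  then have "((\<lambda>z. \<integral>x. F z x \<partial>M) has_field_derivative (\<integral>x. F w x * of_real (ln (L x)) \<partial>M)) (at w)"
    using d by (simp add: has_field_derivative_iff at_within_open[of w "ball w d"])
  then show ?thesis by (simp add: F_def)
qed

section \<open>The half-plane of absolute convergence\<close>

lemma norm_hurwitz_integrand:
  assumes "u > 1"
  shows "norm (hurwitz_integrand r w x u) =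
    (1 - inverse u) powr (- r) * u powr (- Re x - 1) * ln u powr (Re w - 1)"
  using assms by (simp add: hurwitz_integrand_def norm_mult norm_powr_real_powr)

text \<open>For \<open>u > 1\<close> both \<open>u\<close> and \<open>ln u\<close> are positive, so
  the complex powers are exponentials of multiples of real logarithms, which are visibly
  measurable.\<close>

lemma borel_measurable_hurwitz_integrand [measurable]:
  "(\<lambda>u. indicator {1<..} u *\<^sub>R hurwitz_integrand r w x u) \<in> borel_measurable borel"
proof -
  have "(\<lambda>u. indicator {1<..} u *\<^sub>R (of_real ((1 - inverse u) powr (- r)) *
      exp ((- x - 1) * of_real (ln u)) * exp ((w - 1) * of_real (ln (ln u))))) \<in> borel_measurable borel"
    by measurable
  moreover have "(\<lambda>u. indicator {1<..} u *\<^sub>R (of_real ((1 - inverse u) powr (- r)) *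
      exp ((- x - 1) * of_real (ln u)) * exp ((w - 1) * of_real (ln (ln u)))))
    = (\<lambda>u. indicator {1<..} u *\<^sub>R hurwitz_integrand r w x u)"
    by (auto simp: fun_eq_iff indicator_def hurwitz_integrand_def powr_def Ln_of_real)
  ultimately show ?thesis by simp
qed

text \<open>The substitution \<open>t = ln u\<close> turns this into the Gamma integral of
  \<open>t powr (s - 1) * exp (- (a * t))\<close> over \<open>{0<..}\<close>.\<close>

lemma set_integrable_powr_ln_powr:
  fixes s a :: real
  assumes "s > 0" "a > 0"
  shows "set_integrable lborel {1<..} (\<lambda>u. u powr (- a - 1) * ln u powr (s - 1))"
proof -
  define f where "f t = t powr (s - 1) * exp (- (a * t))" for t :: real
  have "(\<lambda>t. norm (complex_of_real t powr (of_real s - 1) / of_real (exp (a * t)))) absolutely_integrable_on {0<..}"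
    using assms absolutely_integrable_Gamma_integral[of "of_real s" a]
    by (intro absolutely_integrable_norm[unfolded o_def]) auto
  also have "?this \<longleftrightarrow> f absolutely_integrable_on {0<..}"
    by (intro set_integrable_cong)
      (auto simp: f_def norm_divide norm_powr_real_powr exp_minus field_simps simp flip: of_real_diff)
  also have "{0<..} = ln ` {1::real<..}"
  proof -
    have "t \<in> ln ` {1<..}" if "t > 0" for t :: real
      using that by (intro image_eqI[of _ _ "exp t"]) auto
    then show ?thesis by auto
  qed
  also have "f absolutely_integrable_on (ln ` {1<..}) \<longleftrightarrow>
      (\<lambda>u. \<bar>inverse u\<bar> * f (ln u)) absolutely_integrable_on {1<..}"
  proof (rule absolutely_integrable_change_of_variables_1')
    show "(ln has_real_derivative inverse u) (at u within {1<..})" if "u \<in> {1<..}" for u :: real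
      using that by (auto intro!: derivative_eq_intros simp: inverse_eq_divide)
  qed (auto intro: inj_onI)
  also have "\<dots> \<longleftrightarrow> (\<lambda>u. u powr (- a - 1) * ln u powr (s - 1)) absolutely_integrable_on {1<..}"
    by (intro set_integrable_cong) (auto simp: f_def powr_def exp_minus exp_diff field_simps exp_add)
  finally show ?thesis
    \<comment> \<open>Passes from Lebesgue measure back to \<open>lborel\<close>, which is possible
      since the function is Borel measurable.\<close>
    unfolding set_integrable_def by (subst (asm) integrable_completion) auto
qed

lemma not_integrable_on_inverse_diff: "\<not> (\<lambda>u::real. inverse (u - 1)) integrable_on {1<..2}"
proof
  let ?f = "\<lambda>u::real. inverse (u - 1)"
  assume int: "?f integrable_on {1<..2}"
  define K where "K = integral {1<..2} ?f"
  \<comment> \<open>Chosen so that the integral over \<open>{1 + e..2}\<close>, which is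
    \<open>- ln e\<close>, equals \<open>\<bar>K\<bar> + 1\<close> and exceeds the supposed total
    \<open>K\<close>.\<close>
  define e where "e = exp (- \<bar>K\<bar> - 1)"
  have e: "e > 0" "e \<le> 1" "ln e = - \<bar>K\<bar> - 1" by (auto simp: e_def)
  have "(?f has_integral (ln (2 - 1) - ln (1 + e - 1))) {1 + e..2}"
    using e by (intro fundamental_theorem_of_calculus)
      (auto intro!: derivative_eq_intros simp: inverse_eq_divide simp flip: has_real_derivative_iff_has_vector_derivative)
  then have *: "(?f has_integral (\<bar>K\<bar> + 1)) {1 + e..2}" using e by (simp add: add.commute)
  have "integral {1 + e..2} ?f \<le> K"
    unfolding K_def using e int * by (intro integral_subset_le) auto
  with * show False by (simp add: integral_unique)
qed

text \<open>Convergence follows by comparison with the Gamma-type integral on all of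
  \<open>{1<..}\<close>; divergence by comparison with \<open>inverse (u - 1)\<close> on
  \<open>{1<..2}\<close>.\<close>

lemma hurwitz_domain_eq:
  assumes "r < 0" "Re x > 0"
  shows "hurwitz_domain r x = {w. Re w > r}"
proof (intro set_eqI iffI)
  fix w assume "w \<in> {w. Re w > r}"
  then have w: "Re w > r" by simp
  have "set_integrable lborel {1<..} (\<lambda>u. u powr (- Re x - 1) * ln u powr (Re w - r - 1))"
    using w assms by (intro set_integrable_powr_ln_powr) auto
  then have "set_integrable lborel {1<..} (hurwitz_integrand r w x)"
    unfolding set_integrable_def
  proof (rule Bochner_Integration.integrable_bound)
    have "norm (hurwitz_integrand r w x u) \<le> u powr (- Re x - 1) * ln u powr (Re w - r - 1)"
      if u: "u > 1" for u
    proof -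
      \<comment> \<open>As \<open>- r\<close> is positive, this bounds the first factor by a power
        of \<open>ln u\<close>, which merges with the last one.\<close>
      have "1 - inverse u \<le> ln u"
        using u ln_le_minus_one[of "inverse u"] by (simp add: ln_inverse)
      then have "(1 - inverse u) powr (- r) \<le> ln u powr (- r)"
        using u assms by (intro powr_mono2) (auto simp: field_simps)
      then have "norm (hurwitz_integrand r w x u)
          \<le> ln u powr (- r) * u powr (- Re x - 1) * ln u powr (Re w - 1)"
        unfolding norm_hurwitz_integrand[OF u] by (intro mult_right_mono) auto
      also have "\<dots> = u powr (- Re x - 1) * (ln u powr (- r) * ln u powr (Re w - 1))" by simp
      also have "\<dots> = u powr (- Re x - 1) * ln u powr (Re w - r - 1)"
        unfolding powr_add[symmetric] by (simp add: algebra_simps)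
      finally show ?thesis .
    qed
    then show "AE u in lborel. norm (indicator {1<..} u *\<^sub>R hurwitz_integrand r w x u)
      \<le> norm (indicator {1<..} u *\<^sub>R (u powr (- Re x - 1) * ln u powr (Re w - r - 1)))"
      by (intro AE_I2) (auto simp: indicator_def abs_mult)
  qed simp
  then show "w \<in> hurwitz_domain r x" by (simp add: hurwitz_domain_def)
next
  fix w assume "w \<in> hurwitz_domain r x"
  then have int: "set_integrable lborel {1<..} (hurwitz_integrand r w x)"
    by (simp add: hurwitz_domain_def)
  show "w \<in> {w. Re w > r}"
  proof (rule ccontr)
    assume "w \<notin> {w. Re w > r}"
    then have w: "Re w \<le> r" by simp
    \<comment> \<open>The first factor comes from \<open>1 - inverse u \<ge> (u - 1) / 2\<close>,
      the second is the least value of \<open>u powr (- Re x - 1)\<close> on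
      \<open>{1<..2}\<close>.\<close>
    define C where "C = 2 powr r * 2 powr (- Re x - 1)"
    have C: "C > 0" by (simp add: C_def)
    have "set_integrable lborel {1<..2} (hurwitz_integrand r w x)"
      by (rule set_integrable_subset[OF int]) auto
    then have "set_integrable lborel {1<..2} (\<lambda>u. C * inverse (u - 1))"
      unfolding set_integrable_def
    proof (rule Bochner_Integration.integrable_bound)
      have "C * inverse (u - 1) \<le> norm (hurwitz_integrand r w x u)" if u: "u > 1" "u \<le> 2" for u
      proof -
        have 1: "(u - 1) / 2 \<le> 1 - inverse u"
        proof -
          have "(u - 1) / 2 \<le> (u - 1) / u" using u by (intro divide_left_mono) auto
          then show ?thesis using u by (simp add: field_simps)
        qed
        have l: "0 < ln u" "ln u \<le> u - 1" using u ln_le_minus_one[of u] by auto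
        have "C * inverse (u - 1) = ((1 / 2) powr (- r) * 2 powr (- Re x - 1)) * (u - 1) powr (- 1)"
          using u by (simp add: C_def powr_minus powr_divide field_simps)
        \<comment> \<open>The base \<open>u - 1\<close> is at most 1 and the new exponent is at most
          -1, so the power grows.\<close>
        also have "\<dots> \<le> ((1 / 2) powr (- r) * 2 powr (- Re x - 1)) * (u - 1) powr (- r + (Re w - 1))"
          using u w by (intro mult_left_mono powr_mono') auto
        also have "\<dots> = ((u - 1) / 2) powr (- r) * 2 powr (- Re x - 1) * (u - 1) powr (Re w - 1)"
          unfolding powr_add using u by (simp add: powr_divide)
        \<comment> \<open>The first exponent is positive, the other two are negative: the first base
          is enlarged, the others are diminished, by \<open>u \<le> 2\<close> and
          \<open>ln u \<le> u - 1\<close>.\<close>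
        also have "\<dots> \<le> (1 - inverse u) powr (- r) * u powr (- Re x - 1) * ln u powr (Re w - 1)"
          using u w assms l 1 by (intro mult_mono powr_mono2 powr_mono2') auto
        finally show ?thesis using norm_hurwitz_integrand[OF u(1), of r w x] by simp
      qed
      then show "AE u in lborel. norm (indicator {1<..2} u *\<^sub>R (C * inverse (u - 1)))
          \<le> norm (indicator {1<..2} u *\<^sub>R hurwitz_integrand r w x u)"
        using C by (intro AE_I2) (auto simp: indicator_def abs_mult)
    qed simp
    then have "(\<lambda>u. C * inverse (u - 1)) integrable_on {1<..2}"
      by (rule set_borel_integral_eq_integral(1))
    then show False
      using not_integrable_on_inverse_diff C by simp
  qed
qed

section \<open>Holomorphy and the continued zeta function\<close>

lemma holomorphic_on_hurwitz_integrand_integral: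
  assumes "r < 0" "Re x > 0"
  shows "(\<lambda>w. LINT u:{1<..}|lborel. hurwitz_integrand r w x u) holomorphic_on {w. Re w > r}"
proof -
  \<comment> \<open>At \<open>w = 1\<close> the power of \<open>ln u\<close> is 1, so
    \<open>g\<close> is the part free of \<open>w\<close>. The remaining exponent is
    \<open>z = w - 1\<close>, hence the shifted half-plane.\<close>
  define g where "g u = indicator {1<..} u *\<^sub>R hurwitz_integrand r 1 x u" for u
  define I where "I z = (\<integral>u. g u * of_real (ln u) powr z \<partial>lborel)" for z
  have F: "g u * of_real (ln u) powr (w - 1) = indicator {1<..} u *\<^sub>R hurwitz_integrand r w x u" for u w
    by (auto simp: g_def hurwitz_integrand_def indicator_def)
  have "I holomorphic_on {z. Re z > r - 1}"
    unfolding holomorphic_on_def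
  proof
    fix z assume z: "z \<in> {z. Re z > r - 1}"
    have "(I has_field_derivative (\<integral>u. g u * of_real (ln u) powr z * of_real (ln (ln u)) \<partial>lborel)) (at z)"
      unfolding I_def
    proof (rule has_field_derivative_integral_powr)
      show "g \<in> borel_measurable lborel" unfolding g_def by simp
      show "open {z. Re z > r - 1}" by (rule open_halfspace_Re_gt)
      show "integrable lborel (\<lambda>u. g u * of_real (ln u) powr z)" if "z \<in> {z. Re z > r - 1}" for z
      proof -
        have "z + 1 \<in> hurwitz_domain r x" using that assms by (simp add: hurwitz_domain_eq)
        then show ?thesis
          using F[of _ "z + 1"] by (simp add: hurwitz_domain_def set_integrable_def)
      qed
    qed (use z in \<open>auto simp: g_def indicator_def split: if_splits\<close>)
    then show "I field_differentiable at z within {z. Re z > r - 1}"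
      using field_differentiable_at_within field_differentiable_def by blast
  qed
  then have "(I \<circ> (\<lambda>w. w - 1)) holomorphic_on {w. Re w > r}"
    by (intro holomorphic_on_compose_gen[of _ _ _ "{z. Re z > r - 1}"]) (auto intro!: holomorphic_intros)
  moreover have "(I \<circ> (\<lambda>w. w - 1)) = (\<lambda>w. LINT u:{1<..}|lborel. hurwitz_integrand r w x u)"
    by (simp add: fun_eq_iff I_def F set_lebesgue_integral_def)
  ultimately show ?thesis by simp
qed

lemma holomorphic_on_hurwitz_integral:
  assumes "r < 0" "Re x > 0"
  shows "(\<lambda>w. hurwitz_integral r w x) holomorphic_on {w. Re w > r}"
  unfolding hurwitz_integral_def
  by (intro holomorphic_intros holomorphic_on_hurwitz_integrand_integral assms)

text \<open>The half-plane itself serves as \<open>S\<close>. Uniqueness is immediate because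
  \<open>w\<close> lies in the domain of convergence, where the value of every admissible
  \<open>f\<close> is prescribed.\<close>

lemma multiple_hurwitz_zeta_eq_integral:
  assumes "r < 0" "Re x > 0" "Re w > r"
  shows "multiple_hurwitz_zeta r w x = hurwitz_integral r w x"
  unfolding multiple_hurwitz_zeta_def
proof (rule the_equality)
  let ?S = "{w. Re w > r}"
  have "connected ?S" by (intro convex_connected convex_halfspace_Re_gt)
  then show "\<exists>S f. open S \<and> connected S \<and> hurwitz_domain r x \<subseteq> S \<and> w \<in> S \<and>
        f holomorphic_on S \<and> (\<forall>z \<in> hurwitz_domain r x. f z = hurwitz_integral r z x) \<and>
        hurwitz_integral r w x = f w"
    using holomorphic_on_hurwitz_integral[of r x] assms
    by (intro exI[of _ ?S] exI[of _ "\<lambda>w. hurwitz_integral r w x"])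
      (auto simp: hurwitz_domain_eq open_halfspace_Re_gt)
qed (use assms in \<open>auto simp: hurwitz_domain_eq\<close>)

section \<open>Zeros and the derivative at the origin\<close>

theorem theorem2:
  fixes r :: real and x :: complex
  assumes "r < 0" and "Re x > 0"
  shows "(\<forall>m::int. r < of_int m \<and> m \<le> 0 \<longrightarrow> multiple_hurwitz_zeta r (of_int m) x = 0) \<and>
    set_integrable lborel {1<..}
      (\<lambda>u::real. of_real ((1 - inverse u) powr (- r)) * of_real u powr (- x - 1) * inverse (of_real (ln u))) \<and>
    multiple_Gamma r x =
      exp (LINT u:{1<..}|lborel.
        of_real ((1 - inverse u) powr (- r)) * of_real u powr (- x - 1) * inverse (of_real (ln u)))"
proof (intro conjI allI impI)
  fix m :: int assume m: "r < of_int m \<and> m \<le> 0"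
  then have "rGamma (of_int m :: complex) = 0"
    by (auto simp: rGamma_eq_zero_iff nonpos_Ints_def)
  then show "multiple_hurwitz_zeta r (of_int m) x = 0"
    using m assms by (simp add: multiple_hurwitz_zeta_eq_integral hurwitz_integral_def)
next
  let ?f = "\<lambda>u::real. of_real ((1 - inverse u) powr (- r)) * of_real u powr (- x - 1) * inverse (of_real (ln u)) :: complex"
  let ?J = "\<lambda>w. LINT u:{1<..}|lborel. hurwitz_integrand r w x u"
  have f: "hurwitz_integrand r 0 x u = ?f u" if "u \<in> {1<..}" for u
    using that by (simp add: hurwitz_integrand_def powr_minus)
  have "0 \<in> hurwitz_domain r x" using assms by (simp add: hurwitz_domain_eq)
  then have "set_integrable lborel {1<..} (hurwitz_integrand r 0 x)"
    by (simp add: hurwitz_domain_def)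
  then show "set_integrable lborel {1<..} ?f"
    using f by (subst set_integrable_cong[symmetric]) auto
  have J: "?J 0 = (LINT u:{1<..}|lborel. ?f u)"
    using f by (intro set_lebesgue_integral_cong) auto
  show "multiple_Gamma r x = exp (LINT u:{1<..}|lborel. ?f u)"
  proof -
    \<comment> \<open>Equality of derivatives at 0 requires the zeta function to agree with
      \<open>rGamma w * ?J w\<close> on a whole neighbourhood, which \<open>r < 0\<close>
      provides.\<close>
    have nhd: "\<forall>\<^sub>F w in nhds 0. Re w > r"
      using assms open_halfspace_Re_gt[of r] by (auto simp: eventually_nhds)
    have "?J field_differentiable at 0"
      using holomorphic_on_hurwitz_integrand_integral[OF assms] open_halfspace_Re_gt[of r] assms
      by (auto intro: holomorphic_on_imp_differentiable_at)
    then have "(?J has_field_derivative deriv ?J 0) (at 0)"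
      by (rule DERIV_deriv_iff_field_differentiable[THEN iffD2])
    moreover have "(rGamma has_field_derivative (1 :: complex)) (at 0)"
      using has_field_derivative_rGamma_nonpos_int[of 0] by simp
    \<comment> \<open>In the product rule the term with \<open>deriv ?J 0\<close> carries the factor
      \<open>rGamma 0 = 0\<close>.\<close>
    ultimately have "((\<lambda>w. rGamma w * ?J w) has_field_derivative ?J 0) (at 0)"
      by (auto intro!: derivative_eq_intros)
    then have "deriv (\<lambda>w. rGamma w * ?J w) 0 = ?J 0"
      by (rule DERIV_imp_deriv)
    moreover have "deriv (\<lambda>w. multiple_hurwitz_zeta r w x) 0 = deriv (\<lambda>w. rGamma w * ?J w) 0"
      using nhd assms
      by (intro deriv_cong_ev) (auto elim!: eventually_mono
        simp: multiple_hurwitz_zeta_eq_integral hurwitz_integral_def)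
    ultimately show ?thesis
      by (simp add: multiple_Gamma_def J)
  qed
qed

end
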